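(* Let $X$ and $Y$ be diffeological spaces, and let $\mathsf{P}$ be a property of smooth maps from $X$ to $Y$. Then $\mathsf{P}$ is stable on $\mathrm{C}^{\infty}(X,Y)$ if and only if $$\mathsf{class}(\mathsf{P})=\{ f\in\mathrm{C}^{\infty}(X,Y)\mid f \text{ possesses the property } \mathsf{P} \}$$ is a D-open subset of $\mathrm{C}^{\infty}(X,Y)$, where $\mathrm{C}^{\infty}(X,Y)$ is equipped with the functional diffeology.
   Context: Functional diffeology: a map $P:U\to \mathrm{C}^{\infty}(X,Y)$ ($U$ open in some $\mathbb{R}^n$) is a plot iff $(u,x)\mapsto P(u)(x)$ is a smooth map $U\times X\to Y$. D-topology: a subset $A$ of a diffeological space is D-open iff its preimage by every plot is open. Stability: the property $\mathsf{P}$ is stable on $\mathrm{C}^{\infty}(X,Y)$ (under small deformations) if for every smooth map $h:\mathbb{R}\to\mathrm{C}^{\infty}(X,Y)$ such that $h(0)$ possesses $\mathsf{P}$, there exists $\epsilon>0$ such that $h(t)$ possesses $\mathsf{P}$ for all $t\in(-\epsilon,\epsilon)$. *)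

theory Defs
  imports "HOL-Analysis.Analysis"
begin

text \<open>
  A diffeology consists of parametrizations of all dimensions, so \<open>\<real>\<^sup>n\<close> cannot be a type here. We use
  the library topology \<^const>\<open>Euclidean_space\<close>, whose points are the sequences \<open>x :: nat \<Rightarrow> real\<close>
  with \<open>x i = 0\<close> for all \<open>i \<ge> n\<close>.
\<close>

definition partial_deriv :: "nat \<Rightarrow> ((nat \<Rightarrow> real) \<Rightarrow> real) \<Rightarrow> (nat \<Rightarrow> real) \<Rightarrow> real" where
  "partial_deriv i f x = deriv (\<lambda>t. f (x(i := t))) (x i)"

text \<open>
  Only used for \<open>U\<close> open in \<open>\<real>\<^sup>n\<close>; it then depends only on the values of \<open>f\<close> on \<open>U\<close>.
\<close>

fun C_k_on :: "nat \<Rightarrow> nat \<Rightarrow> (nat \<Rightarrow> real) set \<Rightarrow> ((nat \<Rightarrow> real) \<Rightarrow> real) \<Rightarrow> bool" where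
  "C_k_on 0 n U f \<longleftrightarrow>
     continuous_map (subtopology (Euclidean_space n) U) euclideanreal f"
| "C_k_on (Suc k) n U f \<longleftrightarrow>
     continuous_map (subtopology (Euclidean_space n) U) euclideanreal f \<and>
     (\<forall>i<n. (\<forall>x\<in>U. (\<lambda>t. f (x(i := t))) field_differentiable (at (x i))) \<and>
            C_k_on k n U (partial_deriv i f))"

definition C_inf_on :: "nat \<Rightarrow> (nat \<Rightarrow> real) set \<Rightarrow> ((nat \<Rightarrow> real) \<Rightarrow> real) \<Rightarrow> bool" where
  "C_inf_on n U f \<longleftrightarrow> (\<forall>k. C_k_on k n U f)"

text \<open>
  \<open>eucl_smooth n U m V\<close> is the set of smooth maps from the open set \<open>U \<subseteq> \<real>\<^sup>n\<close> to \<open>V \<subseteq> \<real>\<^sup>m\<close>. Here and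
  below, maps defined on a set are represented by extensional functions.
\<close>

definition eucl_smooth ::
    "nat \<Rightarrow> (nat \<Rightarrow> real) set \<Rightarrow> nat \<Rightarrow> (nat \<Rightarrow> real) set \<Rightarrow> ((nat \<Rightarrow> real) \<Rightarrow> (nat \<Rightarrow> real)) set" where
  "eucl_smooth n U m V = {F \<in> U \<rightarrow>\<^sub>E V. \<forall>j<m. C_inf_on n U (\<lambda>x. F x j)}"

text \<open>
  \<open>plots X n U\<close> is the set of plots of \<open>X\<close> with domain the open set \<open>U \<subseteq> \<real>\<^sup>n\<close>.
\<close>

record 'a dspace =
  points :: "'a set"
  plots :: "nat \<Rightarrow> (nat \<Rightarrow> real) set \<Rightarrow> ((nat \<Rightarrow> real) \<Rightarrow> 'a) set"

definition diffeological_space :: "'a dspace \<Rightarrow> bool" where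
  "diffeological_space X \<longleftrightarrow>
     (\<forall>n U. \<forall>P\<in>plots X n U. openin (Euclidean_space n) U \<and> P \<in> U \<rightarrow>\<^sub>E points X) \<and>
     (\<forall>n U. \<forall>x\<in>points X. openin (Euclidean_space n) U \<longrightarrow> (\<lambda>u\<in>U. x) \<in> plots X n U) \<and>
     (\<forall>n U. \<forall>P\<in>U \<rightarrow>\<^sub>E points X. openin (Euclidean_space n) U \<longrightarrow>
        (\<forall>u\<in>U. \<exists>V. openin (Euclidean_space n) V \<and> u \<in> V \<and> V \<subseteq> U \<and> restrict P V \<in> plots X n V) \<longrightarrow>
        P \<in> plots X n U) \<and>
     (\<forall>n U m V. \<forall>P\<in>plots X n U. \<forall>F\<in>eucl_smooth m V n U. openin (Euclidean_space m) V \<longrightarrow>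
        compose V P F \<in> plots X m V)"

definition smooth_maps :: "'a dspace \<Rightarrow> 'b dspace \<Rightarrow> ('a \<Rightarrow> 'b) set" where
  "smooth_maps X Y =
     {f \<in> points X \<rightarrow>\<^sub>E points Y. \<forall>n U. \<forall>P\<in>plots X n U. compose U f P \<in> plots Y n U}"

definition eucl_domain :: "nat \<Rightarrow> (nat \<Rightarrow> real) set \<Rightarrow> (nat \<Rightarrow> real) dspace" where
  "eucl_domain n U =
     \<lparr>points = U,
      plots = (\<lambda>m V. {F. openin (Euclidean_space m) V \<and> F \<in> eucl_smooth m V n U})\<rparr>"

definition real_line :: "real dspace" where
  "real_line =
     \<lparr>points = UNIV,
      plots = (\<lambda>n U. {p \<in> U \<rightarrow>\<^sub>E UNIV. openin (Euclidean_space n) U \<and> C_inf_on n U p})\<rparr>"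

definition prod_dspace :: "'a dspace \<Rightarrow> 'b dspace \<Rightarrow> ('a \<times> 'b) dspace" where
  "prod_dspace X Y =
     \<lparr>points = points X \<times> points Y,
      plots = (\<lambda>n U. {P \<in> U \<rightarrow>\<^sub>E points X \<times> points Y.
                 compose U fst P \<in> plots X n U \<and> compose U snd P \<in> plots Y n U})\<rparr>"

definition functional_dspace :: "'a dspace \<Rightarrow> 'b dspace \<Rightarrow> ('a \<Rightarrow> 'b) dspace" where
  "functional_dspace X Y =
     \<lparr>points = smooth_maps X Y,
      plots = (\<lambda>n U. {P \<in> U \<rightarrow>\<^sub>E smooth_maps X Y. openin (Euclidean_space n) U \<and>
                 (\<lambda>(u, x) \<in> U \<times> points X. P u x) \<in> smooth_maps (prod_dspace (eucl_domain n U) X) Y})\<rparr>"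

definition D_open :: "'a dspace \<Rightarrow> 'a set \<Rightarrow> bool" where
  "D_open X A \<longleftrightarrow>
     A \<subseteq> points X \<and>
     (\<forall>n U. \<forall>P\<in>plots X n U. openin (Euclidean_space n) {u \<in> U. P u \<in> A})"

definition stable_property :: "'a dspace \<Rightarrow> 'b dspace \<Rightarrow> (('a \<Rightarrow> 'b) \<Rightarrow> bool) \<Rightarrow> bool" where
  "stable_property X Y Q \<longleftrightarrow>
     (\<forall>h \<in> smooth_maps real_line (functional_dspace X Y).
        Q (h 0) \<longrightarrow> (\<exists>\<epsilon>>0. \<forall>t\<in>{-\<epsilon><..<\<epsilon>}. Q (h t)))"

definition property_class :: "'a dspace \<Rightarrow> 'b dspace \<Rightarrow> (('a \<Rightarrow> 'b) \<Rightarrow> bool) \<Rightarrow> ('a \<Rightarrow> 'b) set" where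
  "property_class X Y Q = {f \<in> smooth_maps X Y. Q f}"

end

theory Submission
  imports Defs
begin

text \<open>
  The D-topology of the functional diffeology is already detected by smooth curves. If the preimage of
  the class under a plot \<open>P\<close> on \<open>U \<subseteq> \<real>\<^sup>n\<close> is not a neighbourhood of one of its points \<open>u\<close>, choose points
  \<open>v\<^sub>k\<close> outside it that converge to \<open>u\<close> so fast that, for a bump function \<open>\<psi>\<close> supported in \<open>[1, 2]\<close> with
  \<open>\<psi>(3/2) = 1\<close>, the curve \<open>c(t) = u + \<Sum>\<^sub>k \<psi>(2\<^sup>k t) (v\<^sub>k - u)\<close> is smooth. Then \<open>c(0) = u\<close> while
  \<open>c(3/2 \<cdot> 2\<^sup>-\<^sup>k) = v\<^sub>k\<close>, so \<open>P \<circ> c\<close> contradicts stability.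
\<close>

subsection \<open>Smooth functions on open subsets of Euclidean spaces\<close>

text \<open>Beyond index \<open>n\<close> all points are 0, so the constraints of a basic open set
  of the product topology hold there automatically, and only the finitely many coordinates below
  \<open>n\<close> have to be controlled.\<close>

lemma openin_Euclidean_space_iff_box:
  "openin (Euclidean_space n) U \<longleftrightarrow>
     U \<subseteq> topspace (Euclidean_space n) \<and>
     (\<forall>u\<in>U. \<exists>r>0. \<forall>x\<in>topspace (Euclidean_space n). (\<forall>i<n. \<bar>x i - u i\<bar> < r) \<longrightarrow> x \<in> U)"
  (is "_ \<longleftrightarrow> ?R")
proof
  assume op: "openin (Euclidean_space n) U"
  then obtain T where T: "openin (powertop_real UNIV) T"
      and U: "U = T \<inter> {x. \<forall>i\<ge>n. x i = 0}"
    unfolding Euclidean_space_def openin_subtopology by blast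
  have "\<exists>r>0. \<forall>x\<in>topspace (Euclidean_space n). (\<forall>i<n. \<bar>x i - u i\<bar> < r) \<longrightarrow> x \<in> U"
    if "u \<in> U" for u
  proof -
    from that U have uT: "u \<in> T" and u0: "\<forall>i\<ge>n. u i = 0" by auto
    from T uT obtain B where B: "\<forall>i. open (B i)" "u \<in> Pi\<^sub>E UNIV B" "Pi\<^sub>E UNIV B \<subseteq> T"
      unfolding openin_product_topology_alt by (metis UNIV_I open_openin)
    \<comment> \<open>Phrased as eventual statements at 0+, the conditions for all
      \<open>i < n\<close> combine into one radius, also when \<open>n = 0\<close>.\<close>
    have "\<forall>\<^sub>F r in at_right 0. \<forall>y. \<bar>y - u i\<bar> < r \<longrightarrow> y \<in> B i" for i
    proof -
      have "u i \<in> B i" using B(2) by auto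
      then obtain e where "e > 0" "\<forall>y. dist y (u i) < e \<longrightarrow> y \<in> B i"
        using B(1) unfolding open_dist by blast
      then show ?thesis
        by (intro eventually_at_rightI[of 0 e]) (auto simp: dist_real_def)
    qed
    then have "\<forall>\<^sub>F r in at_right 0. \<forall>i\<in>{..<n}. \<forall>y. \<bar>y - u i\<bar> < r \<longrightarrow> y \<in> B i"
      by (intro eventually_ball_finite) auto
    then have "\<forall>\<^sub>F r in at_right (0::real). r > 0 \<and> (\<forall>i\<in>{..<n}. \<forall>y. \<bar>y - u i\<bar> < r \<longrightarrow> y \<in> B i)"
      using eventually_at_right_less eventually_conj by blast
    then obtain r where r: "r > 0" "\<forall>i\<in>{..<n}. \<forall>y. \<bar>y - u i\<bar> < r \<longrightarrow> y \<in> B i"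
      using eventually_happens' trivial_limit_at_right_real by blast
    have "x \<in> U" if x: "x \<in> topspace (Euclidean_space n)" "\<forall>i<n. \<bar>x i - u i\<bar> < r" for x
    proof -
      have "x i \<in> B i" for i
      proof (cases "i < n")
        case True
        then show ?thesis using r x by auto
      next
        case False
        then have "x i = u i" using x u0 by (simp add: topspace_Euclidean_space)
        then show ?thesis using B(2) by auto
      qed
      then show ?thesis using B(3) x U by (auto simp: topspace_Euclidean_space)
    qed
    with r show ?thesis by blast
  qed
  then show ?R using openin_subset[OF op] by blast
next
  assume R: ?R
  have "\<exists>T. openin (Euclidean_space n) T \<and> u \<in> T \<and> T \<subseteq> U" if u: "u \<in> U" for u
  proof -
    from R u obtain r where r: "r > 0"
      "\<And>x. x \<in> topspace (Euclidean_space n) \<Longrightarrow> (\<forall>i<n. \<bar>x i - u i\<bar> < r) \<Longrightarrow> x \<in> U"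
      by meson
    define B where "B = Pi\<^sub>E UNIV (\<lambda>i. if i < n then {u i - r<..<u i + r} else UNIV)"
    have "openin (powertop_real UNIV) B"
      unfolding B_def
      by (rule product_topology_basis) (auto intro: finite_subset[of _ "{..<n}"])
    then have "openin (Euclidean_space n) (B \<inter> {x. \<forall>i\<ge>n. x i = 0})"
      unfolding Euclidean_space_def by (rule openin_subtopology_Int)
    moreover have "u \<in> B \<inter> {x. \<forall>i\<ge>n. x i = 0}"
      using r u R by (auto simp: B_def topspace_Euclidean_space)
    moreover have "B \<inter> {x. \<forall>i\<ge>n. x i = 0} \<subseteq> U"
    proof
      fix x assume x: "x \<in> B \<inter> {x. \<forall>i\<ge>n. x i = 0}"
      have "\<bar>x i - u i\<bar> < r" if "i < n" for i
      proof -
        have "x i \<in> (if i < n then {u i - r<..<u i + r} else UNIV)"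
          using x unfolding B_def by blast
        then show ?thesis using that by auto
      qed
      then show "x \<in> U" using x r(2) by (auto simp: topspace_Euclidean_space)
    qed
    ultimately show ?thesis by blast
  qed
  then show "openin (Euclidean_space n) U" using openin_subopen by metis
qed

text \<open>This locality along coordinate lines is what makes partial derivatives on an open
  \<open>U\<close> independent of values outside \<open>U\<close>.\<close>

lemma eventually_fun_upd_in_open:
  assumes "openin (Euclidean_space n) U" "x \<in> U" "i < n"
  shows "\<forall>\<^sub>F t in nhds (x i). x(i := t) \<in> U"
proof -
  from assms obtain r where r: "r > 0"
      "\<And>y. y \<in> topspace (Euclidean_space n) \<Longrightarrow> (\<forall>i<n. \<bar>y i - x i\<bar> < r) \<Longrightarrow> y \<in> U"
    unfolding openin_Euclidean_space_iff_box by meson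
  have x: "x \<in> topspace (Euclidean_space n)" using assms openin_subset by blast
  have "x(i := t) \<in> U" if "dist t (x i) < r" for t
    using x that r assms by (intro r(2)) (auto simp: topspace_Euclidean_space dist_real_def)
  then show ?thesis unfolding eventually_nhds_metric using r(1) by blast
qed

section \<open>Calculus of \<open>C_k_on\<close> by induction on the order\<close>

lemma C_k_on_continuous:
  "C_k_on k n U f \<Longrightarrow> continuous_map (subtopology (Euclidean_space n) U) euclideanreal f"
  by (cases k) auto

lemma C_k_on_Suc_has_derivative:
  assumes "C_k_on (Suc k) n U f" "i < n" "x \<in> U"
  shows "((\<lambda>t. f (x(i := t))) has_field_derivative partial_deriv i f x) (at (x i))"
  using assms field_differentiable_derivI unfolding partial_deriv_def by auto

text \<open>Near a point of \<open>U\<close> both functions agree along each coordinate line, so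
  differentiability and partial derivatives transfer and the induction continues with the partial
  derivatives. The one-sided form suffices, since the roles of \<open>f\<close> and \<open>g\<close>
  can be exchanged.\<close>

lemma C_k_on_cong_aux:
  assumes U: "openin (Euclidean_space n) U"
  shows "C_k_on k n U f \<Longrightarrow> (\<And>x. x \<in> U \<Longrightarrow> f x = g x) \<Longrightarrow> C_k_on k n U g"
proof (induction k arbitrary: f g)
  case 0
  then show ?case
    using U continuous_map_eq[of "subtopology (Euclidean_space n) U" euclideanreal f g]
    by (auto simp: topspace_subtopology)
next
  case (Suc k)
  have ev: "\<forall>\<^sub>F t in nhds (x i). f (x(i := t)) = g (x(i := t))" if "x \<in> U" "i < n" for x i
    using eventually_fun_upd_in_open[OF U that] by eventually_elim (rule Suc.prems)
  have d: "(\<lambda>t. g (x(i := t))) field_differentiable at (x i)" if "x \<in> U" "i < n" for x i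
    using C_k_on_Suc_has_derivative[OF Suc.prems(1) that(2,1)] DERIV_cong_ev[OF refl ev[OF that] refl]
    unfolding field_differentiable_def by blast
  have p: "partial_deriv i f x = partial_deriv i g x" if "x \<in> U" "i < n" for x i
    unfolding partial_deriv_def by (rule deriv_cong_ev[OF ev[OF that] refl])
  have "continuous_map (subtopology (Euclidean_space n) U) euclideanreal g"
    by (rule continuous_map_eq[OF C_k_on_continuous[OF Suc.prems(1)]]) (use Suc.prems(2) in auto)
  moreover have "C_k_on k n U (partial_deriv i g)" if "i < n" for i
    using Suc.IH[of "partial_deriv i f"] Suc.prems(1) that p by auto
  ultimately show ?case using d by auto
qed

lemma C_k_on_cong:
  assumes "openin (Euclidean_space n) U" "\<And>x. x \<in> U \<Longrightarrow> f x = g x"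
  shows "C_k_on k n U f \<longleftrightarrow> C_k_on k n U g"
  using C_k_on_cong_aux[OF assms(1), of k f g] C_k_on_cong_aux[OF assms(1), of k g f] assms(2)
  by metis

lemma C_inf_on_cong:
  assumes "openin (Euclidean_space n) U" "\<And>x. x \<in> U \<Longrightarrow> f x = g x"
  shows "C_inf_on n U f \<longleftrightarrow> C_inf_on n U g"
  unfolding C_inf_on_def by (intro all_cong1 C_k_on_cong[OF assms])

text \<open>Introduction rule for concrete functions: explicit formulas \<open>f'\<close>, valid on
  \<open>U\<close> only, replace \<open>partial_deriv\<close>, which they equal there by uniqueness
  of derivatives.\<close>

lemma C_k_on_SucI:
  assumes U: "openin (Euclidean_space n) U"
    and "continuous_map (subtopology (Euclidean_space n) U) euclideanreal f"
    and d: "\<And>i x. i < n \<Longrightarrow> x \<in> U \<Longrightarrow> ((\<lambda>t. f (x(i := t))) has_field_derivative f' i x) (at (x i))"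
    and "\<And>i. i < n \<Longrightarrow> C_k_on k n U (f' i)"
  shows "C_k_on (Suc k) n U f"
proof -
  have "C_k_on k n U (partial_deriv i f)" if "i < n" for i
  proof -
    have "partial_deriv i f x = f' i x" if "x \<in> U" for x
      unfolding partial_deriv_def by (rule DERIV_imp_deriv[OF d[OF \<open>i < n\<close> that]])
    then show ?thesis using assms(4)[OF that] C_k_on_cong[OF U] by metis
  qed
  then show ?thesis using assms(2) d by (auto simp: field_differentiable_def simp del: fun_upd_apply)
qed

lemma C_k_on_Suc_imp: "C_k_on (Suc k) n U f \<Longrightarrow> C_k_on k n U f"
  by (induction k arbitrary: f) auto

lemma C_k_on_const: "openin (Euclidean_space n) U \<Longrightarrow> C_k_on k n U (\<lambda>x. c)"
  by (induction k arbitrary: c) (auto intro!: C_k_on_SucI[where f' = "\<lambda>_ _. 0"] simp del: C_k_on.simps(2))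

lemma continuous_map_Euclidean_coordinate:
  "continuous_map (subtopology (Euclidean_space n) U) euclideanreal (\<lambda>x. x j)"
  unfolding Euclidean_space_def subtopology_subtopology
  by (intro continuous_map_from_subtopology continuous_map_product_projection) auto

lemma C_k_on_coordinate:
  assumes "openin (Euclidean_space n) U"
  shows "C_k_on k n U (\<lambda>x. x j)"
proof (cases k)
  case 0
  then show ?thesis by (simp add: continuous_map_Euclidean_coordinate)
next
  case (Suc k')
  show ?thesis unfolding Suc
    by (rule C_k_on_SucI[where f' = "\<lambda>i x. if i = j then 1 else 0"])
       (auto intro!: assms continuous_map_Euclidean_coordinate C_k_on_const)
qed

lemma C_inf_on_coordinate: "openin (Euclidean_space n) U \<Longrightarrow> C_inf_on n U (\<lambda>x. x j)"
  by (simp add: C_inf_on_def C_k_on_coordinate)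

lemma C_k_on_add:
  assumes U: "openin (Euclidean_space n) U"
  shows "C_k_on k n U f \<Longrightarrow> C_k_on k n U g \<Longrightarrow> C_k_on k n U (\<lambda>x. f x + g x)"
proof (induction k arbitrary: f g)
  case 0
  then show ?case by (auto intro: continuous_map_add)
next
  case (Suc k)
  show ?case
  proof (rule C_k_on_SucI[OF U, where f' = "\<lambda>i x. partial_deriv i f x + partial_deriv i g x"])
    show "continuous_map (subtopology (Euclidean_space n) U) euclideanreal (\<lambda>x. f x + g x)"
      using Suc.prems by (auto intro: continuous_map_add)
    show "((\<lambda>t. f (x(i := t)) + g (x(i := t))) has_field_derivative
        partial_deriv i f x + partial_deriv i g x) (at (x i))" if "i < n" "x \<in> U" for i x
      by (intro DERIV_add C_k_on_Suc_has_derivative[OF Suc.prems(1) that]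
          C_k_on_Suc_has_derivative[OF Suc.prems(2) that])
    show "C_k_on k n U (\<lambda>x. partial_deriv i f x + partial_deriv i g x)" if "i < n" for i
      using Suc.prems that by (intro Suc.IH) auto
  qed
qed

lemma C_k_on_mult:
  assumes U: "openin (Euclidean_space n) U"
  shows "C_k_on k n U f \<Longrightarrow> C_k_on k n U g \<Longrightarrow> C_k_on k n U (\<lambda>x. f x * g x)"
proof (induction k arbitrary: f g)
  case 0
  then show ?case by (auto intro: continuous_map_real_mult)
next
  case (Suc k)
  show ?case
  proof (rule C_k_on_SucI[OF U, where f' = "\<lambda>i x. partial_deriv i f x * g x + partial_deriv i g x * f x"])
    show "continuous_map (subtopology (Euclidean_space n) U) euclideanreal (\<lambda>x. f x * g x)"
      using Suc.prems by (auto intro: continuous_map_real_mult)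
    show "((\<lambda>t. f (x(i := t)) * g (x(i := t))) has_field_derivative
        partial_deriv i f x * g x + partial_deriv i g x * f x) (at (x i))" if "i < n" "x \<in> U" for i x
      using DERIV_mult[OF C_k_on_Suc_has_derivative[OF Suc.prems(1) that]
          C_k_on_Suc_has_derivative[OF Suc.prems(2) that]] by (simp only: fun_upd_triv)
    show "C_k_on k n U (\<lambda>x. partial_deriv i f x * g x + partial_deriv i g x * f x)" if "i < n" for i
      using Suc.prems that
      by (intro C_k_on_add[OF U] Suc.IH C_k_on_Suc_imp[OF Suc.prems(1)] C_k_on_Suc_imp[OF Suc.prems(2)]) auto
  qed
qed

text \<open>The outer function comes with its whole tower of derivatives, because the chain rule
  leads from \<open>D j\<close> to \<open>D (Suc j)\<close>; the induction therefore runs over all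
  \<open>j\<close> at once.\<close>

lemma C_k_on_compose_real:
  fixes D :: "nat \<Rightarrow> real \<Rightarrow> real"
  assumes U: "openin (Euclidean_space n) U"
    and D: "\<And>j t. (D j has_field_derivative D (Suc j) t) (at t)"
  shows "C_k_on k n U p \<Longrightarrow> C_k_on k n U (\<lambda>x. D j (p x))"
proof (induction k arbitrary: j)
  have cont: "continuous_map (subtopology (Euclidean_space n) U) euclideanreal (\<lambda>x. D j (p x))"
    if "C_k_on k n U p" for j k
  proof -
    have "continuous_on UNIV (D j)"
      using D DERIV_isCont continuous_at_imp_continuous_on by blast
    then show ?thesis
      using continuous_map_compose[OF C_k_on_continuous[OF that], of euclideanreal "D j"]
      by (simp add: o_def)
  qed
  {
    case 0
    then show ?case using cont[of 0] by simp
  next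
    case (Suc k)
    show ?case
    proof (rule C_k_on_SucI[OF U cont[OF Suc.prems], where f' = "\<lambda>i x. D (Suc j) (p x) * partial_deriv i p x"])
      show "((\<lambda>t. D j (p (x(i := t)))) has_field_derivative D (Suc j) (p x) * partial_deriv i p x) (at (x i))"
        if "i < n" "x \<in> U" for i x
        by (rule DERIV_chain2[OF _ C_k_on_Suc_has_derivative[OF Suc.prems that]]) (simp only: fun_upd_triv D)
      show "C_k_on k n U (\<lambda>x. D (Suc j) (p x) * partial_deriv i p x)" if "i < n" for i
        using Suc.prems that by (intro C_k_on_mult[OF U] Suc.IH C_k_on_Suc_imp[OF Suc.prems]) auto
    qed
  }
qed

subsection \<open>Bump functions and rapidly convergent series\<close>

text \<open>The classical flat function exp(-1/x), extended by 0. The extra pole of order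
  \<open>m\<close> makes the span of the family closed under differentiation.\<close>

definition flat :: "nat \<Rightarrow> real \<Rightarrow> real" where
  "flat m x = (if x > 0 then exp (- 1 / x) / x ^ m else 0)"

text \<open>With y = 1/x this says that exp y outgrows y^m as y tends to infinity.\<close>

lemma flat_tendsto_0: "(flat m \<longlongrightarrow> 0) (at_right 0)"
proof -
  have "((\<lambda>x::real. inverse x ^ m / exp (inverse x)) \<longlongrightarrow> 0) (at_right 0)"
    by (rule filterlim_compose[OF tendsto_power_div_exp_0 filterlim_inverse_at_top_right])
  moreover have "\<forall>\<^sub>F x in at_right 0. inverse x ^ m / exp (inverse x) = flat m x"
    using eventually_at_right_less[of 0]
    by eventually_elim (auto simp: flat_def exp_minus field_simps)
  ultimately show ?thesis by (rule Lim_transform_eventually)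
qed

lemma flat_has_derivative:
  "(flat m has_field_derivative flat (m + 2) x - real m * flat (m + 1) x) (at x)"
proof -
  consider "x > 0" | "x < 0" | "x = 0" by linarith
  then show ?thesis
  proof cases
    case 1
    have "((\<lambda>x. exp (- 1 / x) / x ^ m) has_field_derivative
        flat (m + 2) x - real m * flat (m + 1) x) (at x)"
    proof (cases m)
      case 0
      then show ?thesis
        using 1 by (auto intro!: derivative_eq_intros simp: flat_def power2_eq_square)
    next
      case (Suc m')
      show ?thesis
        unfolding Suc using 1
        by (auto intro!: derivative_eq_intros simp: flat_def power2_eq_square)
           (simp add: field_simps, cases m', simp_all)
    qed
    then show ?thesis
      by (rule has_field_derivative_transform_within_open[of _ _ _ "{0<..}"])
         (use 1 in \<open>auto simp: flat_def\<close>)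
  next
    case 2
    have "((\<lambda>x. 0) has_field_derivative flat (m + 2) x - real m * flat (m + 1) x) (at x)"
      using 2 by (auto simp: flat_def)
    then show ?thesis
      by (rule has_field_derivative_transform_within_open[of _ _ _ "{..<0}"])
         (use 2 in \<open>auto simp: flat_def\<close>)
  next
    case 3
    \<comment> \<open>The difference quotient at 0 vanishes on the left and equals
      \<open>flat (m + 1) h\<close> on the right, so it is again covered by
      \<open>flat_tendsto_0\<close>.\<close>
    have "((\<lambda>h. flat m h / h) \<longlongrightarrow> 0) (at 0)"
    proof (rule filterlim_split_at)
      show "((\<lambda>h. flat m h / h) \<longlongrightarrow> 0) (at_left 0)"
        by (rule Lim_transform_eventually[OF tendsto_const])
           (auto simp: flat_def eventually_at_filter)
      show "((\<lambda>h. flat m h / h) \<longlongrightarrow> 0) (at_right 0)"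
        by (rule Lim_transform_eventually[OF flat_tendsto_0[of "m + 1"]])
           (auto simp: flat_def eventually_at_filter)
    qed
    then show ?thesis using 3 by (simp add: DERIV_def flat_def)
  qed
qed

text \<open>A class closed under differentiation, so that vanishing outside (1,2) and boundedness,
  once shown for its members, hold for every derivative of a bump.\<close>

inductive_set bumps :: "(real \<Rightarrow> real) set" where
  base: "(\<lambda>x. flat m (x - 1) * flat n (2 - x)) \<in> bumps"
| add: "f \<in> bumps \<Longrightarrow> g \<in> bumps \<Longrightarrow> (\<lambda>x. f x + g x) \<in> bumps"
| scale: "f \<in> bumps \<Longrightarrow> (\<lambda>x. c * f x) \<in> bumps"

lemma bumps_has_derivative:
  assumes "f \<in> bumps"
  shows "\<exists>f'\<in>bumps. \<forall>x. (f has_field_derivative f' x) (at x)"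
  using assms
proof induction
  case (base m n)
  let ?b = "\<lambda>m n x. flat m (x - 1) * flat n (2 - x)"
  \<comment> \<open>The product rule, arranged as sums and scalar multiples so that membership
    follows from the introduction rules alone; the factor \<open>- 1\<close> comes from the inner
    function 2 - x.\<close>
  let ?f' = "\<lambda>x. (?b (m + 2) n x + - real m * ?b (m + 1) n x)
    + (- 1 * ?b m (n + 2) x + real n * ?b m (n + 1) x)"
  have "(?b m n has_field_derivative ?f' x) (at x)" for x
    by (rule derivative_eq_intros DERIV_chain2[OF flat_has_derivative] refl)+
       (simp add: algebra_simps)
  moreover have "?f' \<in> bumps"
    by (intro bumps.intros)
  ultimately show ?case by (intro bexI[where x = ?f'] allI)
next
  case (add f g)
  then obtain f' g' where "f' \<in> bumps" "g' \<in> bumps"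
      "\<And>x. (f has_field_derivative f' x) (at x)" "\<And>x. (g has_field_derivative g' x) (at x)" by blast
  then show ?case
    by (intro bexI[where x = "\<lambda>x. f' x + g' x"] allI DERIV_add bumps.add)
next
  case (scale f c)
  then obtain f' where "f' \<in> bumps" "\<And>x. (f has_field_derivative f' x) (at x)" by blast
  then show ?case
    by (intro bexI[where x = "\<lambda>x. c * f' x"] allI DERIV_cmult bumps.scale)
qed

lemma bumps_eq_0: "f \<in> bumps \<Longrightarrow> x \<notin> {1<..<2} \<Longrightarrow> f x = 0"
  by (induction rule: bumps.induct) (auto simp: flat_def)

lemma bumps_bounded:
  assumes "f \<in> bumps"
  shows "\<exists>M>0. \<forall>x. \<bar>f x\<bar> \<le> M"
proof -
  have "continuous_on {1..2} f"
    using bumps_has_derivative[OF assms] DERIV_isCont continuous_at_imp_continuous_on by blast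
  then have "bounded (f ` {1..2})"
    by (intro compact_imp_bounded compact_continuous_image) auto
  then obtain M where M: "M > 0" "\<forall>x\<in>{1..2}. \<bar>f x\<bar> \<le> M"
    unfolding bounded_pos by auto
  have "\<bar>f x\<bar> \<le> M" for x
    using M bumps_eq_0[OF assms, of x] by (cases "x \<in> {1..2}") auto
  with M(1) show ?thesis by blast
qed

text \<open>All derivatives of one bump, with exactly the properties that the curve construction
  uses. The value at 3/2 is only nonzero here; dividing by it comes later.\<close>

lemma bump_derivatives:
  obtains D :: "nat \<Rightarrow> real \<Rightarrow> real"
  where "\<And>j x. (D j has_field_derivative D (Suc j) x) (at x)"
    and "\<And>j x. x \<notin> {1<..<2} \<Longrightarrow> D j x = 0"
    and "\<And>j. \<exists>M>0. \<forall>x. \<bar>D j x\<bar> \<le> M"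
    and "D 0 (3/2) \<noteq> 0"
proof -
  define D where "D j = (deriv ^^ j) (\<lambda>x. flat 0 (x - 1) * flat 0 (2 - x))" for j
  have mem: "D j \<in> bumps" for j
  proof (induction j)
    case 0
    show ?case by (simp add: D_def bumps.base)
  next
    case (Suc j)
    then obtain f' where f': "f' \<in> bumps" "\<And>x. (D j has_field_derivative f' x) (at x)"
      using bumps_has_derivative by blast
    have "D (Suc j) = f'"
      using DERIV_imp_deriv[OF f'(2)] by (auto simp: D_def)
    with f' show ?case by simp
  qed
  show thesis
  proof (rule that[of D])
    fix j x
    obtain f' where f': "\<And>x. (D j has_field_derivative f' x) (at x)"
      using bumps_has_derivative[OF mem] by blast
    moreover have "D (Suc j) = f'"
      using DERIV_imp_deriv[OF f'] by (auto simp: D_def)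
    ultimately show "(D j has_field_derivative D (Suc j) x) (at x)" by simp
  qed (use mem bumps_eq_0 bumps_bounded in \<open>auto simp: D_def flat_def\<close>)
qed

section \<open>Series of dyadically rescaled bumps\<close>

text \<open>Differentiating \<open>j\<close> times costs a factor 2^(kj) in the k-th term. The
  quadratic exponent beats this for every \<open>j\<close>: from \<open>k = j + 1\<close> on the
  terms lie below a geometric series.\<close>

lemma summable_half_power_square: "summable (\<lambda>k. 2 ^ (k * j) * (1/2 :: real) ^ (k * k))"
proof (rule summable_comparison_test_ev)
  show "summable (\<lambda>k. (1/2 :: real) ^ k)" by (simp add: summable_geometric)
  have "norm (2 ^ (k * j) * (1/2 :: real) ^ (k * k)) \<le> (1/2) ^ k" if "k \<ge> j + 1" for k
  proof -
    have "k * j + k \<le> k * k" using that mult_le_mono2[of "j + 1" k k] by (simp add: algebra_simps)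
    then have "(1/2 :: real) ^ (k * k) \<le> (1/2) ^ (k * j + k)" by (intro power_decreasing) auto
    then have "2 ^ (k * j) * (1/2 :: real) ^ (k * k) \<le> 2 ^ (k * j) * (1/2) ^ (k * j + k)"
      by (intro mult_left_mono) auto
    also have "\<dots> = (1/2) ^ k" by (simp add: power_add power_divide)
    finally show ?thesis by simp
  qed
  then show "\<forall>\<^sub>F k in sequentially. norm (2 ^ (k * j) * (1/2 :: real) ^ (k * k)) \<le> (1/2) ^ k"
    using eventually_sequentially by blast
qed

text \<open>Termwise differentiation: the differentiated series converges uniformly by the
  Weierstrass M-test. Being stated for every \<open>j\<close>, the result gives a full tower of
  derivatives.\<close>

lemma bump_series_has_derivative:
  fixes D :: "nat \<Rightarrow> real \<Rightarrow> real"
  assumes D: "\<And>j x. (D j has_field_derivative D (Suc j) x) (at x)"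
    and bdd: "\<And>j. \<exists>M>0. \<forall>x. \<bar>D j x\<bar> \<le> M"
    and a: "\<And>k. \<bar>a k\<bar> \<le> C * (1/2) ^ (k * k)"
  shows "((\<lambda>t. \<Sum>k. a k * 2 ^ (k * j) * D j (2 ^ k * t)) has_field_derivative
      (\<Sum>k. a k * 2 ^ (k * Suc j) * D (Suc j) (2 ^ k * t))) (at t)"
proof -
  have ub: "\<exists>M. \<forall>k t. norm (a k * 2 ^ (k * j) * D j (2 ^ k * t)) \<le> M * (2 ^ (k * j) * (1/2) ^ (k * k))"
    for j
  proof -
    obtain M where M: "M > 0" "\<And>x. \<bar>D j x\<bar> \<le> M" using bdd by blast
    have "norm (a k * 2 ^ (k * j) * D j (2 ^ k * t)) \<le> (C * M) * (2 ^ (k * j) * (1/2) ^ (k * k))" for k t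
    proof -
      have "norm (a k * 2 ^ (k * j) * D j (2 ^ k * t)) \<le> (C * (1/2) ^ (k * k) * 2 ^ (k * j)) * M"
        using mult_mono[OF mult_right_mono[OF a[of k], of "2 ^ (k * j)"] M(2)[of "2 ^ k * t"]]
          order_trans[OF abs_ge_zero a, of k]
        by (simp add: abs_mult)
      then show ?thesis by (simp add: mult_ac)
    qed
    then show ?thesis by blast
  qed
  have sm: "summable (\<lambda>k. M * (2 ^ (k * j) * (1/2 :: real) ^ (k * k)))" for M j
    by (intro summable_mult summable_half_power_square)
  have s: "summable (\<lambda>k. a k * 2 ^ (k * j) * D j (2 ^ k * t))" for j t
  proof -
    obtain M where "\<forall>k t. norm (a k * 2 ^ (k * j) * D j (2 ^ k * t)) \<le>
        M * (2 ^ (k * j) * (1/2) ^ (k * k))" using ub by blast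
    then show ?thesis by (intro summable_comparison_test'[OF sm, of 0]) auto
  qed
  show ?thesis
  proof (rule has_field_derivative_series'(2)[where S = UNIV])
    show "((\<lambda>t. a k * 2 ^ (k * j) * D j (2 ^ k * t)) has_field_derivative
        a k * 2 ^ (k * Suc j) * D (Suc j) (2 ^ k * t)) (at t within UNIV)" for k t
      by (rule derivative_eq_intros DERIV_chain2[OF D] refl)+ (simp add: power_add)
    obtain M where M: "\<And>k t. norm (a k * 2 ^ (k * Suc j) * D (Suc j) (2 ^ k * t)) \<le>
        M * (2 ^ (k * Suc j) * (1/2) ^ (k * k))" using ub by blast
    show "uniformly_convergent_on UNIV (\<lambda>n t. \<Sum>k<n. a k * 2 ^ (k * Suc j) * D (Suc j) (2 ^ k * t))"
      by (rule Weierstrass_m_test'[OF M sm])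
  qed (use s in auto)
qed

subsection \<open>Smooth curves and plots of the functional diffeology\<close>

lemma points_simps [simp]:
  "points (eucl_domain n U) = U"
  "points real_line = UNIV"
  "points (prod_dspace X Y) = points X \<times> points Y"
  "points (functional_dspace X Y) = smooth_maps X Y"
  by (simp_all add: eucl_domain_def real_line_def prod_dspace_def functional_dspace_def)

lemma smooth_maps_in_points: "f \<in> smooth_maps X Y \<Longrightarrow> x \<in> points X \<Longrightarrow> f x \<in> points Y"
  by (auto simp: smooth_maps_def)

lemma smooth_maps_plot: "f \<in> smooth_maps X Y \<Longrightarrow> P \<in> plots X n U \<Longrightarrow> compose U f P \<in> plots Y n U"
  by (auto simp: smooth_maps_def)

lemma diffeological_space_plot_compose:
  assumes "diffeological_space X" "P \<in> plots X n U" "F \<in> eucl_smooth m V n U"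
    "openin (Euclidean_space m) V"
  shows "compose V P F \<in> plots X m V"
  using assms(1)[unfolded diffeological_space_def, THEN conjunct2, THEN conjunct2, THEN conjunct2]
    assms(2-) by blast

text \<open>Smoothness of a curve is tested on all plots \<open>p\<close> of the line. Each
  coordinate of the composite is a smooth real function after \<open>p\<close>, so one tower of
  ordinary derivatives per coordinate is enough.\<close>

lemma smooth_maps_real_lineI:
  assumes U: "openin (Euclidean_space n) U" and cU: "\<And>t. c t \<in> U"
    and D: "\<And>i. i < n \<Longrightarrow> \<exists>D. D 0 = (\<lambda>t. c t i) \<and>
      (\<forall>j t. (D j has_field_derivative D (Suc j) t) (at t))"
  shows "c \<in> smooth_maps real_line (eucl_domain n U)"
proof -
  have "C_inf_on m V (\<lambda>x. compose V c p x i)"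
    if V: "openin (Euclidean_space m) V" "C_inf_on m V p" and i: "i < n" for m V p i
  proof -
    obtain D where D0: "D 0 = (\<lambda>t. c t i)"
        and D: "\<And>j t. (D j has_field_derivative D (Suc j) t) (at t)"
      using D[OF i] by blast
    have "C_inf_on m V (\<lambda>x. D 0 (p x))"
      using V C_k_on_compose_real[of m V D _ p 0] D by (auto simp: C_inf_on_def)
    moreover have "compose V c p x i = D 0 (p x)" if "x \<in> V" for x
      using that by (simp add: compose_def D0)
    ultimately show ?thesis using C_inf_on_cong[OF V(1)] by metis
  qed
  then show ?thesis
    using cU by (auto simp: smooth_maps_def real_line_def eucl_domain_def eucl_smooth_def compose_def)
qed

text \<open>A form of the special curve lemma. Adherence of \<open>u\<close> to \<open>B\<close>
  supplies points of \<open>B\<close> in arbitrarily small cubes around \<open>u\<close>, hence a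
  sequence converging as fast as desired.\<close>

lemma smooth_curve_through_sequence:
  assumes U: "openin (Euclidean_space n) U" and u: "u \<in> U" "u \<in> Euclidean_space n closure_of B"
  obtains c t where "c \<in> smooth_maps real_line (eucl_domain n U)" "c 0 = u"
    "t \<longlonglongrightarrow> (0::real)" "\<And>k::nat. c (t k) \<in> B"
proof -
  obtain r where r: "r > 0"
      "\<And>x. x \<in> topspace (Euclidean_space n) \<Longrightarrow> (\<forall>i<n. \<bar>x i - u i\<bar> < r) \<Longrightarrow> x \<in> U"
    using U u unfolding openin_Euclidean_space_iff_box by meson
  have uE: "u i = 0" if "i \<ge> n" for i
    using openin_subset[OF U] u that by (auto simp: topspace_Euclidean_space)
  obtain D where D: "\<And>j x. (D j has_field_derivative D (Suc j) x) (at x)"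
      and D0: "\<And>j x. x \<notin> {1<..<2} \<Longrightarrow> D j x = 0"
      and bdd: "\<And>j. \<exists>M>0. \<forall>x. \<bar>D j x\<bar> \<le> M"
      and nz: "D 0 (3/2) \<noteq> (0::real)"
    using bump_derivatives by blast
  obtain M where M: "M > 0" "\<And>x. \<bar>D 0 x\<bar> \<le> M" using bdd by blast
  \<comment> \<open>The displacement will be bounded by the sum of C M (1/2)^k, which is 2 C M =
    r/2, so the curve stays in the cube of radius \<open>r\<close> inside \<open>U\<close>.\<close>
  define C where "C = r / (4 * M)"
  have C: "C > 0" using r M by (simp add: C_def)
  \<comment> \<open>The factor \<open>\<bar>D 0 (3/2)\<bar>\<close> cancels when the displacements
    are divided by \<open>D 0 (3/2)\<close> to normalize the bump.\<close>
  have "\<exists>v. v \<in> B \<and> v \<in> topspace (Euclidean_space n) \<and>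
      (\<forall>i<n. \<bar>v i - u i\<bar> < \<bar>D 0 (3/2)\<bar> * (C * (1/2) ^ (k * k)))" for k :: nat
  proof -
    define e where "e = \<bar>D 0 (3/2)\<bar> * (C * (1/2) ^ (k * k))"
    have e: "e > 0" using nz C by (simp add: e_def)
    define T where "T = {x \<in> topspace (Euclidean_space n). \<forall>i<n. \<bar>x i - u i\<bar> < e}"
    have "openin (Euclidean_space n) T"
      unfolding openin_Euclidean_space_iff_box
    proof (intro conjI ballI)
      show "T \<subseteq> topspace (Euclidean_space n)" by (auto simp: T_def)
      fix w assume w: "w \<in> T"
      have "\<forall>\<^sub>F s in at_right 0. \<forall>i\<in>{..<n}. s < e - \<bar>w i - u i\<bar>"
        using w by (intro eventually_ball_finite) (auto simp: T_def intro!: order_tendstoD tendsto_ident_at)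
      then have "\<forall>\<^sub>F s in at_right 0. 0 < s \<and> (\<forall>i\<in>{..<n}. s < e - \<bar>w i - u i\<bar>)"
        using eventually_at_right_less eventually_conj by blast
      then obtain s where s: "0 < s" "\<forall>i\<in>{..<n}. s < e - \<bar>w i - u i\<bar>"
        using eventually_happens' trivial_limit_at_right_real by blast
      have "x \<in> T" if "x \<in> topspace (Euclidean_space n)" "\<forall>i<n. \<bar>x i - w i\<bar> < s" for x
      proof -
        have "\<bar>x i - u i\<bar> < e" if "i < n" for i
        proof -
          have "\<bar>x i - w i\<bar> < s" "s < e - \<bar>w i - u i\<bar>"
            using that \<open>\<forall>i<n. \<bar>x i - w i\<bar> < s\<close> s by auto
          then show ?thesis by linarith
        qed
        then show ?thesis using that by (simp add: T_def)
      qed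
      then show "\<exists>s>0. \<forall>x\<in>topspace (Euclidean_space n). (\<forall>i<n. \<bar>x i - w i\<bar> < s) \<longrightarrow> x \<in> T"
        using s(1) by blast
    qed
    moreover have "u \<in> T" using e openin_subset[OF U] u by (auto simp: T_def)
    ultimately obtain v where "v \<in> B" "v \<in> T"
      using u(2) unfolding in_closure_of by blast
    then show ?thesis by (auto simp: T_def e_def)
  qed
  then obtain v where vB: "\<And>k. v k \<in> B" and vE: "\<And>k. v k \<in> topspace (Euclidean_space n)"
      and v: "\<And>k i. i < n \<Longrightarrow> \<bar>v k i - u i\<bar> < \<bar>D 0 (3/2)\<bar> * (C * (1/2) ^ (k * k))"
    by metis
  define a where "a i k = (v k i - u i) / D 0 (3/2)" for i k
  have a: "\<bar>a i k\<bar> \<le> C * (1/2) ^ (k * k)" for i k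
  proof (cases "i < n")
    case True
    then show ?thesis using v[OF True, of k] nz by (simp add: a_def abs_divide divide_le_eq mult.commute)
  next
    case False
    then show ?thesis using uE[of i] vE[of k] C by (simp add: a_def topspace_Euclidean_space)
  qed
  define S where "S i j t = (\<Sum>k. a i k * 2 ^ (k * j) * D j (2 ^ k * t))" for i j t
  have S: "(S i j has_field_derivative S i (Suc j) t) (at t)" for i j t
    unfolding S_def by (rule bump_series_has_derivative[of D "a i" C, OF D bdd a])
  define c where "c t = (\<lambda>i. u i + S i 0 t)" for t
  have "c t \<in> U" for t
  proof (rule r(2))
    show "c t \<in> topspace (Euclidean_space n)"
      \<comment> \<open>For \<open>i \<ge> n\<close> both \<open>u\<close> and every
        \<open>v k\<close> vanish, hence so do all coefficients \<open>a i k\<close>.\<close>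
      using uE vE by (simp add: c_def S_def a_def topspace_Euclidean_space)
    have "\<bar>S i 0 t\<bar> < r" for i
    proof -
      have sm: "summable (\<lambda>k. (C * M) * (1/2 :: real) ^ k)"
        by (intro summable_mult summable_geometric) simp
      have le: "norm (a i k * 2 ^ (k * 0) * D 0 (2 ^ k * t)) \<le> (C * M) * (1/2) ^ k" for k
      proof -
        \<comment> \<open>Weakened to a geometric bound, whose sum is explicit.\<close>
        have "(1/2 :: real) ^ (k * k) \<le> (1/2) ^ k" by (intro power_decreasing) (cases k, auto)
        then have "\<bar>a i k\<bar> \<le> C * (1/2) ^ k"
          using a[of i k] C by (meson mult_left_mono order_trans less_imp_le)
        then have "\<bar>a i k\<bar> * \<bar>D 0 (2 ^ k * t)\<bar> \<le> (C * (1/2) ^ k) * M"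
          using M C by (intro mult_mono) auto
        then show ?thesis by (simp add: abs_mult mult_ac)
      qed
      have "norm (S i 0 t) \<le> (\<Sum>k. (C * M) * (1/2 :: real) ^ k)"
        unfolding S_def by (rule norm_suminf_le[OF le sm])
      also have "\<dots> = 2 * (C * M)"
        by (simp add: suminf_mult suminf_geometric)
      also have "\<dots> < r" using r M by (simp add: C_def)
      finally show ?thesis by simp
    qed
    then show "\<forall>i<n. \<bar>c t i - u i\<bar> < r" by (simp add: c_def)
  qed
  moreover have "\<exists>D. D 0 = (\<lambda>t. c t i) \<and> (\<forall>j t. (D j has_field_derivative D (Suc j) t) (at t))" for i
  \<comment> \<open>The constant \<open>u i\<close> is present in order 0 only, whence the case
    distinction.\<close>
  proof (intro exI[of _ "\<lambda>j. case j of 0 \<Rightarrow> (\<lambda>t. u i + S i 0 t) | Suc _ \<Rightarrow> S i j"] conjI allI)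
    show "((case j of 0 \<Rightarrow> (\<lambda>t. u i + S i 0 t) | Suc _ \<Rightarrow> S i j) has_field_derivative
       (case Suc j of 0 \<Rightarrow> (\<lambda>t. u i + S i 0 t) | Suc _ \<Rightarrow> S i (Suc j)) t) (at t)" for j t
      using S[of i j t] by (cases j) (auto intro!: derivative_eq_intros)
  qed (simp add: c_def)
  ultimately have "c \<in> smooth_maps real_line (eucl_domain n U)"
    using smooth_maps_real_lineI[OF U] by blast
  \<comment> \<open>At \<open>t = 0\<close> every bump is evaluated at 0, outside its
    support.\<close>
  moreover have "c 0 = u"
    by (simp add: c_def S_def D0)
  moreover have "(\<lambda>k. (3/2) * (1/2 :: real) ^ k) \<longlonglongrightarrow> 0"
    by (intro tendsto_mult_right_zero LIMSEQ_power_zero) simp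
  moreover have "c ((3/2) * (1/2) ^ k) \<in> B" for k
  proof -
    define s :: real where "s = (3/2) * (1/2) ^ k"
    \<comment> \<open>The rescaled supports are disjoint: 2^l s is 3/2 times 2^(l-k), hence at most
      3/4 for \<open>l < k\<close> and at least 3 for \<open>l > k\<close>. Only the k-th term
      survives at \<open>s\<close>.\<close>
    have *: "D 0 (2 ^ l * s) = 0" if "l \<noteq> k" for l
    proof (rule D0, cases "l < k")
      case True
      then obtain d where k: "k = Suc (l + d)" using less_imp_Suc_add by blast
      have "(1 :: real) \<le> 2 ^ d" by simp
      then have "2 ^ l * s \<le> 3/4"
        by (simp add: s_def k power_add power_divide divide_le_eq)
      then show "2 ^ l * s \<notin> {1<..<2}" by simp
    next
      case False
      with that obtain d where l: "l = Suc (k + d)" using less_imp_Suc_add nat_neq_iff by metis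
      have "(1 :: real) \<le> 2 ^ d" by simp
      then have "2 ^ l * s \<ge> 3"
        by (simp add: s_def l power_add power_divide)
      then show "2 ^ l * s \<notin> {1<..<2}" by simp
    qed
    have "S i 0 s = a i k * D 0 (2 ^ k * s)" for i
      unfolding S_def by (subst suminf_finite[of "{k}"]) (auto simp: *)
    moreover have "2 ^ k * s = 3/2" by (simp add: s_def power_divide)
    ultimately have "c s = v k"
      using nz by (simp add: c_def a_def)
    then show ?thesis using vB by (simp add: s_def)
  qed
  ultimately show thesis by (rule that)
qed

text \<open>
  On \<open>V \<times> W\<close> the two arguments of \<open>P\<close> are reparametrized separately, by projections; restricting to the
  graph of \<open>F\<close> with the axioms of \<open>Y\<close> then avoids composing two multivariate smooth maps directly.
\<close>

lemma functional_dspace_plot_compose: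
  assumes X: "diffeological_space X" and Y: "diffeological_space Y"
    and P: "P \<in> plots (functional_dspace X Y) n U"
    and G: "G \<in> eucl_smooth m V n U" and V: "openin (Euclidean_space m) V"
  shows "compose V P G \<in> plots (functional_dspace X Y) m V"
proof -
  have Pm: "P \<in> U \<rightarrow>\<^sub>E smooth_maps X Y" and U: "openin (Euclidean_space n) U"
    and Ps: "(\<lambda>(u, x) \<in> U \<times> points X. P u x) \<in> smooth_maps (prod_dspace (eucl_domain n U) X) Y"
    using P by (auto simp: functional_dspace_def)
  have GU: "G v \<in> U" if "v \<in> V" for v using G that by (auto simp: eucl_smooth_def)
  let ?\<Phi> = "\<lambda>(u, x) \<in> U \<times> points X. P u x"
  let ?\<Psi> = "\<lambda>(v, x) \<in> V \<times> points X. compose V P G v x"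
  have "compose W ?\<Psi> T \<in> plots Y k W"
    if T: "T \<in> plots (prod_dspace (eucl_domain m V) X) k W" for k W T
  proof -
    define F R where "F = compose W fst T" and "R = compose W snd T"
    have TW: "T \<in> W \<rightarrow>\<^sub>E V \<times> points X" and W: "openin (Euclidean_space k) W"
      and F: "F \<in> eucl_smooth k W m V" and R: "R \<in> plots X k W"
      using T by (auto simp: prod_dspace_def eucl_domain_def F_def R_def)
    have WE: "w i = 0" if "w \<in> W" "i \<ge> k" for w i
      using openin_subset[OF W] that by (auto simp: topspace_Euclidean_space)
    have VE: "w i = 0" if "w \<in> V" "i \<ge> m" for w i
      using openin_subset[OF V] that by (auto simp: topspace_Euclidean_space)
    \<comment> \<open>The projections that split the first \<open>m\<close> coordinates from the
      next \<open>k\<close>; \<open>Z\<close> then plays the part of the product of \<open>V\<close>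
      and \<open>W\<close>.\<close>
    define pr1 :: "(nat \<Rightarrow> real) \<Rightarrow> nat \<Rightarrow> real" where "pr1 z = (\<lambda>i. if i < m then z i else 0)" for z
    define pr2 :: "(nat \<Rightarrow> real) \<Rightarrow> nat \<Rightarrow> real" where "pr2 z = (\<lambda>i. z (i + m))" for z
    define Z where "Z = {z \<in> topspace (Euclidean_space (m + k)). pr1 z \<in> V \<and> pr2 z \<in> W}"
    have Z: "openin (Euclidean_space (m + k)) Z"
      unfolding openin_Euclidean_space_iff_box
    proof (intro conjI ballI)
      show "Z \<subseteq> topspace (Euclidean_space (m + k))" by (auto simp: Z_def)
      fix z assume z: "z \<in> Z"
      obtain r where r: "r > 0"
        "\<And>x. x \<in> topspace (Euclidean_space m) \<Longrightarrow> (\<forall>i<m. \<bar>x i - pr1 z i\<bar> < r) \<Longrightarrow> x \<in> V"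
        using V z unfolding openin_Euclidean_space_iff_box Z_def by blast
      obtain s where s: "s > 0"
        "\<And>x. x \<in> topspace (Euclidean_space k) \<Longrightarrow> (\<forall>i<k. \<bar>x i - pr2 z i\<bar> < s) \<Longrightarrow> x \<in> W"
        using W z unfolding openin_Euclidean_space_iff_box Z_def by blast
      have "x \<in> Z" if x: "x \<in> topspace (Euclidean_space (m + k))" "\<forall>i<m + k. \<bar>x i - z i\<bar> < min r s" for x
      proof -
        have "pr1 x \<in> V" using x by (intro r(2)) (auto simp: pr1_def topspace_Euclidean_space)
        moreover have "pr2 x \<in> W" using x by (intro s(2)) (auto simp: pr2_def topspace_Euclidean_space)
        ultimately show ?thesis using x by (simp add: Z_def)
      qed
      then show "\<exists>r>0. \<forall>x\<in>topspace (Euclidean_space (m + k)).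
          (\<forall>i<m + k. \<bar>x i - z i\<bar> < r) \<longrightarrow> x \<in> Z"
        using r(1) s(1) by (intro exI[of _ "min r s"]) auto
    qed
    have pr1_cont: "continuous_map (subtopology (Euclidean_space (m + k)) Z)
        (subtopology (Euclidean_space m) V) pr1"
    proof -
      have "continuous_map (subtopology (Euclidean_space (m + k)) Z) (powertop_real UNIV) pr1"
        unfolding continuous_map_componentwise_UNIV
      proof
        fix i
        show "continuous_map (subtopology (Euclidean_space (m + k)) Z) euclideanreal (\<lambda>z. pr1 z i)"
          by (cases "i < m") (auto simp: pr1_def continuous_map_Euclidean_coordinate)
      qed
      then show ?thesis
        unfolding Euclidean_space_def continuous_map_in_subtopology
        by (auto simp: Z_def pr1_def)
    qed
    \<comment> \<open>Varying \<open>z i\<close> moves the same coordinate of \<open>pr1 z\<close>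
      if \<open>i < m\<close> and leaves \<open>pr1 z\<close> fixed otherwise, so each partial
      derivative is again a composite with \<open>pr1\<close>, or 0.\<close>
    have pr1_smooth: "C_k_on l m V f \<Longrightarrow> C_k_on l (m + k) Z (\<lambda>z. f (pr1 z))" for l f
    proof (induction l arbitrary: f)
      case 0
      then show ?case using continuous_map_compose[OF pr1_cont, of euclideanreal f] by (simp add: o_def)
    next
      case (Suc l)
      show ?case
      proof (rule C_k_on_SucI[OF Z, where f' = "\<lambda>i z. if i < m then partial_deriv i f (pr1 z) else 0"])
        show "continuous_map (subtopology (Euclidean_space (m + k)) Z) euclideanreal (\<lambda>z. f (pr1 z))"
          using continuous_map_compose[OF pr1_cont C_k_on_continuous[OF Suc.prems]] by (simp add: o_def)
        show "((\<lambda>t. f (pr1 (z(i := t)))) has_field_derivative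
            (if i < m then partial_deriv i f (pr1 z) else 0)) (at (z i))" if "z \<in> Z" for z i
        proof (cases "i < m")
          case True
          then have "pr1 (z(i := t)) = (pr1 z)(i := t)" "pr1 z i = z i" for t by (auto simp: pr1_def)
          then show ?thesis
            using C_k_on_Suc_has_derivative[OF Suc.prems True, of "pr1 z"] that True
            by (simp add: Z_def del: fun_upd_apply)
        next
          case False
          then have "pr1 (z(i := t)) = pr1 z" for t by (auto simp: pr1_def)
          then show ?thesis using False by simp
        qed
        show "C_k_on l (m + k) Z (\<lambda>z. if i < m then partial_deriv i f (pr1 z) else 0)" for i
          using Suc.IH[of "partial_deriv i f"] Suc.prems C_k_on_const[OF Z] by (cases "i < m") auto
      qed
    qed
    define T' where "T' = (\<lambda>z\<in>Z. (G (pr1 z), R (pr2 z)))"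
    have "(\<lambda>z\<in>Z. G (pr1 z)) \<in> eucl_smooth (m + k) Z n U"
    proof -
      have "C_inf_on (m + k) Z (\<lambda>z. G (pr1 z) j)" if "j < n" for j
        using G that pr1_smooth[of _ "\<lambda>v. G v j"] by (auto simp: eucl_smooth_def C_inf_on_def)
      then have "C_inf_on (m + k) Z (\<lambda>z. (\<lambda>z\<in>Z. G (pr1 z)) z j)" if "j < n" for j
        using C_inf_on_cong[OF Z, of "\<lambda>z. G (pr1 z) j" "\<lambda>z. (\<lambda>z\<in>Z. G (pr1 z)) z j"] that by simp
      then show ?thesis using GU by (auto simp: eucl_smooth_def Z_def)
    qed
    moreover have "compose Z fst T' = (\<lambda>z\<in>Z. G (pr1 z))"
      by (auto simp: compose_def T'_def)
    moreover have "compose Z snd T' \<in> plots X (m + k) Z"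
    proof -
      have "C_inf_on (m + k) Z (\<lambda>z. restrict pr2 Z z j)" for j
        using C_inf_on_cong[OF Z, of "\<lambda>z. z (j + m)" "\<lambda>z. restrict pr2 Z z j"] C_inf_on_coordinate[OF Z]
        by (simp add: pr2_def)
      then have "restrict pr2 Z \<in> eucl_smooth (m + k) Z k W"
        by (auto simp: eucl_smooth_def Z_def)
      then have "compose Z R (restrict pr2 Z) \<in> plots X (m + k) Z"
        using diffeological_space_plot_compose[OF X R _ Z] by blast
      moreover have "compose Z R (restrict pr2 Z) = compose Z snd T'"
        by (auto simp: compose_def T'_def)
      ultimately show ?thesis by simp
    qed
    moreover have "T' \<in> Z \<rightarrow>\<^sub>E U \<times> points X"
    proof -
      have "R w \<in> points X" if "w \<in> W" for w using TW that by (auto simp: R_def compose_def PiE_iff mem_Times_iff)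
      then show ?thesis using GU by (auto simp: T'_def Z_def)
    qed
    ultimately have "T' \<in> plots (prod_dspace (eucl_domain n U) X) (m + k) Z"
      using Z by (simp add: prod_dspace_def eucl_domain_def)
    then have \<Phi>T': "compose Z ?\<Phi> T' \<in> plots Y (m + k) Z"
      by (rule smooth_maps_plot[OF Ps])
    \<comment> \<open>The graph map w -> (F w, w). After it, the map on \<open>Z\<close> takes the
      value \<open>P (G (F w)) (R w)\<close>, which is \<open>?\<Psi>\<close> at
      \<open>T w\<close>.\<close>
    define J where "J = (\<lambda>w\<in>W. \<lambda>i. if i < m then F w i else w (i - m))"
    have FV: "F w \<in> V" if "w \<in> W" for w using F that by (auto simp: eucl_smooth_def)
    have pr1J: "pr1 (J w) = F w" and pr2J: "pr2 (J w) = w" if "w \<in> W" for w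
      using that VE[OF FV[OF that]] by (auto simp: J_def pr1_def pr2_def)
    have JZ: "J w \<in> Z" if "w \<in> W" for w
      using pr1J[OF that] pr2J[OF that] FV[OF that] that WE[OF that]
      by (auto simp: Z_def topspace_Euclidean_space J_def)
    have "C_inf_on k W (\<lambda>w. J w j)" for j
    proof (cases "j < m")
      case True
      then show ?thesis
        using C_inf_on_cong[OF W, of "\<lambda>w. F w j" "\<lambda>w. J w j"] F by (simp add: J_def eucl_smooth_def)
    next
      case False
      then show ?thesis
        using C_inf_on_cong[OF W, of "\<lambda>w. w (j - m)" "\<lambda>w. J w j"] C_inf_on_coordinate[OF W]
        by (simp add: J_def)
    qed
    then have "J \<in> eucl_smooth k W (m + k) Z"
      using JZ by (auto simp: eucl_smooth_def J_def)
    then have "compose W (compose Z ?\<Phi> T') J \<in> plots Y k W"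
      using diffeological_space_plot_compose[OF Y \<Phi>T' _ W] by blast
    moreover have "compose W (compose Z ?\<Phi> T') J = compose W ?\<Psi> T"
    proof
      fix w
      show "compose W (compose Z ?\<Phi> T') J w = compose W ?\<Psi> T w"
      proof (cases "w \<in> W")
        case True
        then have Tw: "T w = (F w, R w)" by (simp add: F_def R_def compose_def)
        moreover have "R w \<in> points X" using TW True Tw by (auto simp: PiE_iff)
        ultimately show ?thesis
          using True JZ[OF True] GU FV[OF True] pr1J[OF True] pr2J[OF True]
          by (simp add: compose_def T'_def)
      qed (simp add: compose_def)
    qed
    ultimately show ?thesis by simp
  qed
  moreover have "compose V P G \<in> V \<rightarrow>\<^sub>E smooth_maps X Y"
    using Pm GU by (auto simp: compose_def)
  moreover from this have "?\<Psi> \<in> points (prod_dspace (eucl_domain m V) X) \<rightarrow>\<^sub>E points Y"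
    by (auto dest!: PiE_mem intro: smooth_maps_in_points)
  ultimately have "?\<Psi> \<in> smooth_maps (prod_dspace (eucl_domain m V) X) Y"
    by (simp add: smooth_maps_def[of "prod_dspace _ _"])
  with V \<open>compose V P G \<in> V \<rightarrow>\<^sub>E smooth_maps X Y\<close> show ?thesis
    by (simp add: functional_dspace_def)
qed

text \<open>Turns a curve in the domain of a plot into a deformation to which stability applies: a
  plot of the line followed by \<open>c\<close> is a smooth reparametrization of
  \<open>P\<close>.\<close>

lemma plot_compose_smooth_curve:
  assumes X: "diffeological_space X" and Y: "diffeological_space Y"
    and P: "P \<in> plots (functional_dspace X Y) n U"
    and c: "c \<in> smooth_maps real_line (eucl_domain n U)"
  shows "(\<lambda>t. P (c t)) \<in> smooth_maps real_line (functional_dspace X Y)"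
proof -
  have "compose V (\<lambda>t. P (c t)) p \<in> plots (functional_dspace X Y) m V"
    if p: "p \<in> plots real_line m V" for m V p
  proof -
    have "compose V c p \<in> eucl_smooth m V n U" "openin (Euclidean_space m) V"
      using smooth_maps_plot[OF c p] by (auto simp: eucl_domain_def)
    then have "compose V P (compose V c p) \<in> plots (functional_dspace X Y) m V"
      by (rule functional_dspace_plot_compose[OF X Y P])
    moreover have "compose V P (compose V c p) = compose V (\<lambda>t. P (c t)) p"
      by (auto simp: compose_def)
    ultimately show ?thesis by simp
  qed
  moreover have "P (c t) \<in> smooth_maps X Y" for t
    using P smooth_maps_in_points[OF c, of t] by (auto simp: functional_dspace_def)
  ultimately show ?thesis
    by (auto simp: smooth_maps_def[of real_line])
qed

section \<open>Equivalence of stability and D-openness\<close>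

theorem proposition1p3:
  fixes X :: "'a dspace" and Y :: "'b dspace" and Q :: "('a \<Rightarrow> 'b) \<Rightarrow> bool"
  assumes "diffeological_space X" and "diffeological_space Y"
  shows "stable_property X Y Q \<longleftrightarrow> D_open (functional_dspace X Y) (property_class X Y Q)"
proof
  assume st: "stable_property X Y Q"
  have "openin (Euclidean_space n) {u \<in> U. P u \<in> property_class X Y Q}" (is "openin _ ?O")
    if P: "P \<in> plots (functional_dspace X Y) n U" for n U P
  proof (rule ccontr)
    assume no: "\<not> openin (Euclidean_space n) ?O"
    have U: "openin (Euclidean_space n) U" and PU: "\<And>u. u \<in> U \<Longrightarrow> P u \<in> smooth_maps X Y"
      using P by (auto simp: functional_dspace_def)
    have "\<not> (\<forall>u\<in>?O. \<exists>T. openin (Euclidean_space n) T \<and> u \<in> T \<and> T \<subseteq> ?O)"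
      using no openin_subopen[of "Euclidean_space n" ?O] by blast
    then obtain u where u: "u \<in> ?O" "\<And>T. openin (Euclidean_space n) T \<Longrightarrow> u \<in> T \<Longrightarrow> \<not> T \<subseteq> ?O"
      by blast
    have "u \<in> Euclidean_space n closure_of (U - ?O)"
      unfolding in_closure_of
    proof (intro conjI allI impI)
      show "u \<in> topspace (Euclidean_space n)" using u(1) openin_subset[OF U] by auto
      fix T assume "u \<in> T \<and> openin (Euclidean_space n) T"
      \<comment> \<open>Intersecting with \<open>U\<close> yields a point outside \<open>?O\<close>
        that still lies in the domain of \<open>P\<close>.\<close>
      then have "\<not> T \<inter> U \<subseteq> ?O" using u(1) by (intro u(2) openin_Int U) auto
      then show "\<exists>y. y \<in> U - ?O \<and> y \<in> T" by blast
    qed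
    then obtain c t where c: "c \<in> smooth_maps real_line (eucl_domain n U)" "c 0 = u"
        and t: "t \<longlonglongrightarrow> 0" "\<And>k. c (t k) \<in> U - ?O"
      using smooth_curve_through_sequence[OF U] u(1) by blast
    have "Q (P (c 0))" using u(1) c(2) by (simp add: property_class_def)
    then obtain e where e: "e > 0" "\<And>s. s \<in> {-e<..<e} \<Longrightarrow> Q (P (c s))"
      using st[unfolded stable_property_def, rule_format, OF plot_compose_smooth_curve[OF assms P c(1)]]
      by blast
    have "\<forall>\<^sub>F k in sequentially. \<bar>t k\<bar> < e"
      using t(1) e(1) by (auto simp: tendsto_iff dist_real_def)
    then obtain k where "\<bar>t k\<bar> < e" using eventually_happens' sequentially_bot by blast
    then have "Q (P (c (t k)))" by (intro e(2)) auto
    \<comment> \<open>Since \<open>P (c (t k))\<close> is a smooth map, being outside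
      \<open>?O\<close> can only mean that \<open>Q\<close> fails there.\<close>
    then show False using t(2)[of k] PU by (auto simp: property_class_def)
  qed
  then show "D_open (functional_dspace X Y) (property_class X Y Q)"
    by (auto simp: D_open_def property_class_def functional_dspace_def)
next
  assume op: "D_open (functional_dspace X Y) (property_class X Y Q)"
  show "stable_property X Y Q"
    unfolding stable_property_def
  proof (intro ballI impI)
    fix h assume h: "h \<in> smooth_maps real_line (functional_dspace X Y)" and Q0: "Q (h 0)"
    \<comment> \<open>Plots live on sets of sequences, so the line is parametrized by the coordinate
      \<open>?p\<close> on \<open>Euclidean_space 1\<close>; composing \<open>h\<close> with it
      gives a plot on which D-openness can be tested.\<close>
    let ?E = "topspace (Euclidean_space 1)"
    let ?p = "\<lambda>x\<in>?E. x 0 :: real"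
    have E: "openin (Euclidean_space 1) ?E" by simp
    have "C_inf_on 1 ?E ?p"
      using C_inf_on_cong[OF E, of "\<lambda>x. x 0" ?p] C_inf_on_coordinate[OF E] by simp
    then have "?p \<in> plots real_line 1 ?E" by (simp add: real_line_def)
    then have "compose ?E h ?p \<in> plots (functional_dspace X Y) 1 ?E"
      by (rule smooth_maps_plot[OF h])
    then have O: "openin (Euclidean_space 1) {x \<in> ?E. compose ?E h ?p x \<in> property_class X Y Q}"
      (is "openin _ ?O") using op unfolding D_open_def by blast
    have hm: "h t \<in> smooth_maps X Y" for t
      using smooth_maps_in_points[OF h] by simp
    \<comment> \<open>The zero sequence corresponds to the parameter \<open>t = 0\<close>; a box
      around it in dimension 1 is an interval around 0.\<close>
    have "(\<lambda>_. 0) \<in> ?O"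
      using Q0 hm by (simp add: compose_def property_class_def topspace_Euclidean_space)
    then obtain e where e: "e > 0" "\<And>x. x \<in> ?E \<Longrightarrow> (\<forall>i<1. \<bar>x i - 0\<bar> < e) \<Longrightarrow> x \<in> ?O"
      using O unfolding openin_Euclidean_space_iff_box by meson
    have "Q (h s)" if "s \<in> {-e<..<e}" for s
    proof -
      have E: "(\<lambda>_. 0)(0 := s) \<in> ?E" by (simp add: topspace_Euclidean_space)
      moreover have "(\<lambda>_. 0)(0 := s) \<in> ?O" by (rule e(2)[OF E]) (use that in auto)
      ultimately show ?thesis by (simp add: compose_def property_class_def)
    qed
    then show "\<exists>e>0. \<forall>t\<in>{-e<..<e}. Q (h t)" using e(1) by blast
  qed
qed

end
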